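(* For every finite graph $G$, $\operatorname{pw}(G)\le \mathcal{L}^m(G)$.
   Context: Lions and contamination game. Let $G=(V,E)$ be a finite graph, $N(v)$ the set of neighbours of $v$. A lion strategy with $k\ge 1$ lions consists of initial positions $p_1(0),\dots,p_k(0)\in V$ and, for each $t\ge 1$, positions $p_i(t)\in\{p_i(t-1)\}\cup N(p_i(t-1))$. Put $L_t=\{p_i(t)\}_i$, $\pi_t=\{(p_i(t-1),p_i(t))\}_i$. Contaminated sets: $W_0=V\setminus L_0$, and for $t\ge1$, $W_t=(W_{t-1}\setminus L_t)\cup\{v\in V\setminus L_t:\exists w\in W_{t-1}\cap N(v)\text{ with }(v,w)\notin\pi_t,(w,v)\notin\pi_t\}$. The strategy clears $G$ if $W_T=\emptyset$ for some $T$. It is monotone if $W_t\subseteq W_{t-1}$ for all $t\ge1$. The monotone lion number $\mathcal{L}^m(G)$ is the minimum number of lions of a monotone strategy clearing $G$. $\operatorname{pw}(G)$ denotes the pathwidth of $G$. *)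

theory Defs
  imports "Graph_Theory.Pair_Digraph" "HOL-Library.Extended_Nat"
begin

text \<open>
  A finite simple graph is a \<^locale>\<open>pair_graph\<close>: a finite, loop-free, symmetric set
  of arcs, so that an undirected edge is a pair of opposite arcs.
\<close>

definition nbrs :: "'a pair_pre_digraph \<Rightarrow> 'a \<Rightarrow> 'a set" where
  "nbrs G v = {w. (v, w) \<in> parcs G}"

subsection \<open>Pathwidth\<close>

definition path_decomposition :: "'a pair_pre_digraph \<Rightarrow> 'a set list \<Rightarrow> bool" where
  "path_decomposition G Xs \<longleftrightarrow>
     Xs \<noteq> [] \<and>
     \<Union>(set Xs) = pverts G \<and>
     (\<forall>(u, v) \<in> parcs G. \<exists>X \<in> set Xs. u \<in> X \<and> v \<in> X) \<and>
     (\<forall>i j k. i \<le> j \<and> j \<le> k \<and> k < length Xs \<longrightarrow> Xs ! i \<inter> Xs ! k \<subseteq> Xs ! j)"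

text \<open>
  The truncated subtraction matters only for the graph without vertices, whose
  width is 0 here instead of the value -1 used by some authors.
\<close>

definition pd_width :: "'a set list \<Rightarrow> nat" where
  "pd_width Xs = Max (card ` set Xs) - 1"

definition pathwidth :: "'a pair_pre_digraph \<Rightarrow> nat" where
  "pathwidth G = (LEAST w. \<exists>Xs. path_decomposition G Xs \<and> pd_width Xs = w)"

subsection \<open>Lions and contamination\<close>

text \<open>
  \<open>p i t\<close> is the position of lion \<open>i\<close> at time \<open>t\<close>; the \<open>k\<close> lions are numbered
  from \<open>0\<close> to \<open>k - 1\<close>, and values of \<open>p\<close> at other indices are irrelevant.
\<close>

definition lion_strategy :: "'a pair_pre_digraph \<Rightarrow> nat \<Rightarrow> (nat \<Rightarrow> nat \<Rightarrow> 'a) \<Rightarrow> bool" where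
  "lion_strategy G k p \<longleftrightarrow>
     k \<ge> 1 \<and>
     (\<forall>i<k. p i 0 \<in> pverts G) \<and>
     (\<forall>i<k. \<forall>t\<ge>1. p i t \<in> {p i (t - 1)} \<union> nbrs G (p i (t - 1)))"

definition lion_set :: "nat \<Rightarrow> (nat \<Rightarrow> nat \<Rightarrow> 'a) \<Rightarrow> nat \<Rightarrow> 'a set" where
  "lion_set k p t = {p i t | i. i < k}"

text \<open>Only meaningful for \<open>t \<ge> 1\<close>.\<close>

definition lion_moves :: "nat \<Rightarrow> (nat \<Rightarrow> nat \<Rightarrow> 'a) \<Rightarrow> nat \<Rightarrow> ('a \<times> 'a) set" where
  "lion_moves k p t = {(p i (t - 1), p i t) | i. i < k}"

primrec contaminated ::
  "'a pair_pre_digraph \<Rightarrow> nat \<Rightarrow> (nat \<Rightarrow> nat \<Rightarrow> 'a) \<Rightarrow> nat \<Rightarrow> 'a set" where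
  "contaminated G k p 0 = pverts G - lion_set k p 0"
| "contaminated G k p (Suc t) =
     (contaminated G k p t - lion_set k p (Suc t)) \<union>
     {v \<in> pverts G - lion_set k p (Suc t).
        \<exists>w \<in> contaminated G k p t \<inter> nbrs G v.
          (v, w) \<notin> lion_moves k p (Suc t) \<and> (w, v) \<notin> lion_moves k p (Suc t)}"

definition clears :: "'a pair_pre_digraph \<Rightarrow> nat \<Rightarrow> (nat \<Rightarrow> nat \<Rightarrow> 'a) \<Rightarrow> bool" where
  "clears G k p \<longleftrightarrow> (\<exists>T. contaminated G k p T = {})"

definition monotone_strategy :: "'a pair_pre_digraph \<Rightarrow> nat \<Rightarrow> (nat \<Rightarrow> nat \<Rightarrow> 'a) \<Rightarrow> bool" where
  "monotone_strategy G k p \<longleftrightarrow> (\<forall>t\<ge>1. contaminated G k p t \<subseteq> contaminated G k p (t - 1))"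

text \<open>
  The value is \<open>\<infinity>\<close> if there is no monotone clearing strategy. This happens only for the
  graph without vertices, on which no lion can be placed.
\<close>

definition monotone_lion_number :: "'a pair_pre_digraph \<Rightarrow> enat" where
  "monotone_lion_number G =
     Inf {enat k | k. \<exists>p. lion_strategy G k p \<and> monotone_strategy G k p \<and> clears G k p}"

lemma pathwidth_attained:
  "\<exists>Xs. path_decomposition G Xs \<and> pd_width Xs = pathwidth G" if "pair_graph G"
proof -
  interpret pair_graph G by fact
  have "path_decomposition G [pverts G]"
    by (auto simp: path_decomposition_def dest: in_arcsD1 in_arcsD2)
  then have "\<exists>w Xs. path_decomposition G Xs \<and> pd_width Xs = w" by blast
  then show ?thesis unfolding pathwidth_def by (rule LeastI_ex)
qed

lemma monotone_lion_number_attained: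
  assumes "pair_graph G" "pverts G \<noteq> {}"
  shows "\<exists>k p. monotone_lion_number G = enat k \<and>
           lion_strategy G k p \<and> monotone_strategy G k p \<and> clears G k p"
proof -
  interpret pair_graph G by fact
  let ?S = "{enat k | k. \<exists>p. lion_strategy G k p \<and> monotone_strategy G k p \<and> clears G k p}"
  let ?n = "card (pverts G)"
  obtain f where f: "f ` {..<?n} = pverts G"
    using ex_bij_betw_nat_finite[OF pair_finite_verts]
    by (auto simp: bij_betw_def atLeast0LessThan)
  define p where "p = (\<lambda>i (t::nat). f i)"
  have L: "lion_set ?n p t = pverts G" for t
    using f by (auto simp: lion_set_def p_def)
  have W: "contaminated G ?n p t = {}" for t
    by (induction t) (simp_all add: L)
  have "?n \<ge> 1"
    using assms(2) pair_finite_verts by (simp add: Suc_le_eq card_gt_0_iff)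
  then have "lion_strategy G ?n p"
    using f by (auto simp: lion_strategy_def p_def)
  then have "enat ?n \<in> ?S"
    using W by (auto simp: monotone_strategy_def clears_def)
  then have "Inf ?S \<in> ?S" by (rule wellorder_InfI)
  then show ?thesis by (auto simp: monotone_lion_number_def)
qed

end

theory Submission
  imports Defs
begin

text \<open>
  Let \<open>C\<^sub>t\<close> be the set of cleared vertices at time \<open>t\<close>; monotonicity says that these sets
  increase. Every set \<open>B\<close> with \<open>C\<^sub>t \<subseteq> B \<subseteq> C\<^sub>t\<^sub>+\<^sub>1\<close> has at most \<open>k\<close> vertices with a neighbour
  outside \<open>B\<close>: such a vertex
  either carries a lion at time \<open>t + 1\<close>, or a lion has just left it towards a vertex
  outside \<open>B\<close>, and all these lions are distinct. Hence the vertices can be added one at a time,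
  in any order compatible with the clearing, and the bags consisting of the current
  boundary and the next vertex form a path decomposition of width at most \<open>k\<close>.
\<close>

definition inner_boundary :: "'a pair_pre_digraph \<Rightarrow> 'a set \<Rightarrow> 'a set" where
  "inner_boundary G C = {u \<in> C. \<not> nbrs G u \<subseteq> C}"

text \<open>
  A path decomposition of the subgraph induced on \<open>C\<close> that can still be continued to
  the right, with bags of at most \<open>k + 1\<close> vertices.
\<close>

definition partial_path_decomposition ::
  "'a pair_pre_digraph \<Rightarrow> nat \<Rightarrow> 'a set \<Rightarrow> 'a set list \<Rightarrow> bool" where
  "partial_path_decomposition G k C Xs \<longleftrightarrow>
     Xs \<noteq> [] \<and>
     \<Union>(set Xs) = C \<and>
     (\<forall>(u, v) \<in> parcs G. u \<in> C \<and> v \<in> C \<longrightarrow> (\<exists>X \<in> set Xs. u \<in> X \<and> v \<in> X)) \<and>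
     (\<forall>i j l. i \<le> j \<and> j \<le> l \<and> l < length Xs \<longrightarrow> Xs ! i \<inter> Xs ! l \<subseteq> Xs ! j) \<and>
     (\<forall>X \<in> set Xs. card X \<le> k + 1) \<and>
     inner_boundary G C \<subseteq> last Xs"

lemma partial_path_decomposition_empty: "partial_path_decomposition G k {} [{}]"
  by (auto simp: partial_path_decomposition_def inner_boundary_def)

text \<open>Every neighbour of \<open>v\<close> in \<open>C\<close> has \<open>v\<close> as a
  neighbour outside \<open>C\<close>, so it lies in the boundary and the new bag covers all new
  edges. The new bag also contains the next boundary, because enlarging \<open>C\<close> puts no old
  vertex on it.\<close>

lemma partial_path_decomposition_insert:
  assumes "pair_graph G"
    and P: "partial_path_decomposition G k C Xs"
    and card: "card (inner_boundary G C) \<le> k"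
    and v: "v \<notin> C"
  shows "partial_path_decomposition G k (insert v C) (Xs @ [insert v (inner_boundary G C)])"
proof -
  interpret pair_graph G by fact
  let ?B = "inner_boundary G C"
  let ?Ys = "Xs @ [insert v ?B]"
  have ne: "Xs \<noteq> []" and un: "\<Union>(set Xs) = C"
    and arcs: "\<And>a b. (a, b) \<in> parcs G \<Longrightarrow> a \<in> C \<Longrightarrow> b \<in> C \<Longrightarrow> \<exists>X \<in> set Xs. a \<in> X \<and> b \<in> X"
    and conv: "\<And>i j l. i \<le> j \<Longrightarrow> j \<le> l \<Longrightarrow> l < length Xs \<Longrightarrow> Xs ! i \<inter> Xs ! l \<subseteq> Xs ! j"
    and size: "\<And>X. X \<in> set Xs \<Longrightarrow> card X \<le> k + 1"
    and bd: "?B \<subseteq> last Xs"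
    using P by (auto simp: partial_path_decomposition_def)
  have BC: "?B \<subseteq> C" by (auto simp: inner_boundary_def)
  have sym: "(b, a) \<in> parcs G" if "(a, b) \<in> parcs G" for a b
    using that arcs_symmetric by blast
  have new: "a \<in> ?B" if "(a, v) \<in> parcs G" "a \<in> C" for a
    using that v by (auto simp: inner_boundary_def nbrs_def)
  have arcs': "\<exists>X \<in> set ?Ys. a \<in> X \<and> b \<in> X"
    if "(a, b) \<in> parcs G" "a \<in> insert v C" "b \<in> insert v C" for a b
  proof (cases "a \<in> C \<and> b \<in> C")
    case True
    then show ?thesis using arcs that(1) by fastforce
  next
    case False
    then have "a \<in> insert v ?B \<and> b \<in> insert v ?B"
      using that new sym by blast
    then show ?thesis by simp
  qed
  have conv': "?Ys ! i \<inter> ?Ys ! l \<subseteq> ?Ys ! j"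
    if "i \<le> j" "j \<le> l" "l < length ?Ys" for i j l
  proof (cases "l < length Xs")
    case True
    then show ?thesis using that conv[of i j l] by (simp add: nth_append)
  next
    case l: False
    show ?thesis
    proof (cases "j < length Xs")
      case True
      \<comment> \<open>As \<open>v\<close> is not in \<open>C\<close>, the old bag meets the new
        one only inside the boundary, hence inside \<open>last Xs\<close>; the interval property of
        \<open>Xs\<close> then carries over.\<close>
      have "Xs ! i \<subseteq> C" using un True that(1) by (metis Union_upper le_less_trans nth_mem)
      moreover have "Xs ! i \<inter> last Xs \<subseteq> Xs ! j"
        using conv[of i j "length Xs - 1"] True that(1) ne by (simp add: last_conv_nth)
      moreover have "l = length Xs" using l that(3) by simp
      ultimately show ?thesis using True that(1) bd v by (auto simp: nth_append)
    next
      case False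
      then have "j = l" using that l by simp
      then show ?thesis by simp
    qed
  qed
  have "card (insert v ?B) \<le> k + 1"
    using card card_insert_le_m1[of "k + 1" ?B v] by simp
  then have size': "\<forall>X \<in> set ?Ys. card X \<le> k + 1" using size by simp
  have bd': "inner_boundary G (insert v C) \<subseteq> last ?Ys"
    by (auto simp: inner_boundary_def)
  have un': "\<Union>(set ?Ys) = insert v C" using un BC by auto
  show ?thesis
    unfolding partial_path_decomposition_def
  proof (intro conjI)
    show "?Ys \<noteq> []" by simp
    show "\<forall>(a, b) \<in> parcs G. a \<in> insert v C \<and> b \<in> insert v C \<longrightarrow>
        (\<exists>X \<in> set ?Ys. a \<in> X \<and> b \<in> X)"
      using arcs' by blast
    show "\<forall>i j l. i \<le> j \<and> j \<le> l \<and> l < length ?Ys \<longrightarrow> ?Ys ! i \<inter> ?Ys ! l \<subseteq> ?Ys ! j"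
      using conv' by presburger
  qed (fact size' bd' un')+
qed

text \<open>One move can clear several vertices at once, while bags are added for single vertices.
  The intermediate sets depend on the order of insertion, so the bound is required for every set
  between \<open>C\<close> and \<open>D\<close>.\<close>

lemma partial_path_decomposition_extend:
  assumes G: "pair_graph G"
    and P: "\<exists>Xs. partial_path_decomposition G k C Xs"
    and "C \<subseteq> D" "finite D"
    and bound: "\<And>B. C \<subseteq> B \<Longrightarrow> B \<subseteq> D \<Longrightarrow> card (inner_boundary G B) \<le> k"
  shows "\<exists>Xs. partial_path_decomposition G k D Xs"
proof -
  have "F \<subseteq> D - C \<Longrightarrow> \<exists>Xs. partial_path_decomposition G k (C \<union> F) Xs" if "finite F" for F
    using that
  proof (induction F)
    case empty
    then show ?case using P by simp
  next
    case (insert v F)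
    then obtain Xs where "partial_path_decomposition G k (C \<union> F) Xs" by auto
    moreover have "card (inner_boundary G (C \<union> F)) \<le> k"
      using insert.prems \<open>C \<subseteq> D\<close> by (intro bound) auto
    moreover have "v \<notin> C \<union> F" using insert by blast
    ultimately have "partial_path_decomposition G k (insert v (C \<union> F))
        (Xs @ [insert v (inner_boundary G (C \<union> F))])"
      by (rule partial_path_decomposition_insert[OF G])
    then show ?case unfolding Un_insert_right by blast
  qed
  from this[of "D - C"] show ?thesis
    using assms(3,4) by (simp add: Un_absorb1)
qed

lemma pathwidth_le:
  assumes "partial_path_decomposition G k (pverts G) Xs" "pair_graph G"
  shows "pathwidth G \<le> k"
proof -
  interpret pair_graph G by fact
  have arcs: "\<forall>(a, b) \<in> parcs G. a \<in> pverts G \<and> b \<in> pverts G \<longrightarrow>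
      (\<exists>X \<in> set Xs. a \<in> X \<and> b \<in> X)"
    using assms(1) unfolding partial_path_decomposition_def by (elim conjE)
  have "\<exists>X \<in> set Xs. a \<in> X \<and> b \<in> X" if ab: "(a, b) \<in> parcs G" for a b
    using bspec[OF arcs ab] in_arcsD1[OF ab] in_arcsD2[OF ab] by simp
  then have "\<forall>(a, b) \<in> parcs G. \<exists>X \<in> set Xs. a \<in> X \<and> b \<in> X"
    by blast
  then have "path_decomposition G Xs"
    using assms(1) unfolding partial_path_decomposition_def path_decomposition_def
    by (elim conjE) (intro conjI)
  then have "pathwidth G \<le> pd_width Xs"
    unfolding pathwidth_def by (intro Least_le) blast
  also have "pd_width Xs \<le> k"
  proof -
    have "Max (card ` set Xs) \<le> k + 1"
      using assms(1) by (subst Max_le_iff) (auto simp: partial_path_decomposition_def)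
    then show ?thesis by (simp add: pd_width_def)
  qed
  finally show ?thesis .
qed

lemma lion_set_eq_image: "lion_set k p t = (\<lambda>i. p i t) ` {..<k}"
  by (auto simp: lion_set_def)

lemma card_inner_boundary_between_cleared:
  assumes B: "pverts G - contaminated G k p t \<subseteq> B" "B \<subseteq> pverts G - contaminated G k p (Suc t)"
    and G: "pair_graph G"
  shows "card (inner_boundary G B) \<le> k"
proof -
  interpret pair_graph G by fact
  have "\<exists>i<k. p i (Suc t) = u \<or> (p i (Suc t) \<notin> B \<and> p i t = u)" if "u \<in> inner_boundary G B" for u
  proof (cases "u \<in> lion_set k p (Suc t)")
    case True
    then show ?thesis by (auto simp: lion_set_def)
  next
    case False
    from that obtain w where uB: "u \<in> B" and w: "w \<in> nbrs G u" "w \<notin> B"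
      by (auto simp: inner_boundary_def)
    \<comment> \<open>Contamination at \<open>w\<close> did not spread to the unoccupied
      \<open>u\<close>, so a lion crossed this edge; it cannot have ended on \<open>u\<close>, hence
      it went from \<open>u\<close> to \<open>w\<close>.\<close>
    then have "w \<in> contaminated G k p t"
      using B(1) by (auto simp: nbrs_def dest: in_arcsD2)
    moreover have "u \<in> pverts G" "u \<notin> contaminated G k p (Suc t)" using uB B(2) by auto
    ultimately have "(u, w) \<in> lion_moves k p (Suc t) \<or> (w, u) \<in> lion_moves k p (Suc t)"
      using False w by auto
    moreover have "(w, u) \<notin> lion_moves k p (Suc t)"
      using False by (auto simp: lion_moves_def lion_set_def)
    ultimately show ?thesis using w by (auto simp: lion_moves_def)
  qed
  then obtain f where f: "\<And>u. u \<in> inner_boundary G B \<Longrightarrow>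
      f u < k \<and> (p (f u) (Suc t) = u \<or> (p (f u) (Suc t) \<notin> B \<and> p (f u) t = u))"
    by metis
  have "inner_boundary G B \<subseteq> B" by (auto simp: inner_boundary_def)
  \<comment> \<open>The end position of a lion decides its case: inside \<open>B\<close> it is the
    assigned vertex itself, outside \<open>B\<close> the assigned vertex is where the lion started.
    Either way the lion determines the vertex.\<close>
  then have "inj_on f (inner_boundary G B)"
    using f by (intro inj_onI) (metis subsetD)
  moreover have "f ` inner_boundary G B \<subseteq> {..<k}" using f by auto
  ultimately show ?thesis using card_inj_on_le[of f _ "{..<k}"] by simp
qed

lemma monotone_strategy_partial_path_decomposition:
  assumes G: "pair_graph G" and mono: "monotone_strategy G k p"
  shows "\<exists>Xs. partial_path_decomposition G k (pverts G - contaminated G k p t) Xs"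
proof (induction t)
  interpret pair_graph G by fact
  case 0
  \<comment> \<open>Initially only vertices carrying lions are clear, so any set of cleared vertices
    has at most \<open>k\<close> elements.\<close>
  have "card (inner_boundary G B) \<le> k" if "B \<subseteq> pverts G - contaminated G k p 0" for B
  proof -
    have "inner_boundary G B \<subseteq> (\<lambda>i. p i 0) ` {..<k}"
      using that by (auto simp: inner_boundary_def lion_set_eq_image)
    then show ?thesis by (metis card_lessThan finite_lessThan surj_card_le)
  qed
  moreover have "\<exists>Xs. partial_path_decomposition G k {} Xs"
    using partial_path_decomposition_empty by (rule exI)
  ultimately show ?case
    using partial_path_decomposition_extend[OF G, of k "{}"] pair_finite_verts by simp
next
  interpret pair_graph G by fact
  case (Suc t)
  have "contaminated G k p (Suc t) \<subseteq> contaminated G k p t"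
    using mono unfolding monotone_strategy_def by (metis diff_Suc_1 le_add1 plus_1_eq_Suc)
  \<comment> \<open>Monotonicity enters here: the cleared sets form an increasing chain.\<close>
  then have "pverts G - contaminated G k p t \<subseteq> pverts G - contaminated G k p (Suc t)" by blast
  then show ?case
    using pair_finite_verts card_inner_boundary_between_cleared[OF _ _ G]
    by (rule partial_path_decomposition_extend[OF G Suc _ finite_Diff])
qed

theorem theorem25:
  fixes G :: "'a pair_pre_digraph"
  assumes "pair_graph G"
  shows "enat (pathwidth G) \<le> monotone_lion_number G"
proof -
  \<comment> \<open>Once no contamination is left, the cleared set is all of
    \<open>pverts G\<close>.\<close>
  have "pathwidth G \<le> k" if "monotone_strategy G k p" "clears G k p" for k p
    using that monotone_strategy_partial_path_decomposition[OF assms that(1)] pathwidth_le assms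
    by (metis Diff_empty clears_def)
  then show ?thesis
    by (auto simp: monotone_lion_number_def intro!: Inf_greatest)
qed

end
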